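(* Let $\mathsf{F}:\mathbb{R}^n\to\mathbb{R}^n$ be strongly monotone with parameter $m>0$ and Lipschitz on $(\mathbb{R}^n,\|\cdot\|_2)$ with constant $\ell$, and let $g:\mathbb{R}^n\to[-\infty,+\infty]$ be convex, closed, and proper. For $\gamma>0$ consider the dynamics $$\dot x=-x+\operatorname{prox}_{\gamma g}(x-\gamma\mathsf{F}(x)).\qquad(\ast)$$ Then: (i) for every $\gamma\in\,]0,2m/\ell^2[$, the dynamics $(\ast)$ are strongly infinitesimally contracting with respect to $\|\cdot\|_2$ with rate $1-\sqrt{1-2\gamma m+\gamma^2\ell^2}$. Moreover, this contraction rate is optimized (maximized over $\gamma$) at $\gamma^*=m/\ell^2$. Additionally, (ii) if $\mathsf{F}=\nabla f$ for some strongly convex $f:\mathbb{R}^n\to\mathbb{R}$, then for every $\gamma\in\,]0,2/\ell[$, the dynamics $(\ast)$ are strongly infinitesimally contracting with respect to $\|\cdot\|_2$ with rate $1-\max\{|1-\gamma m|,|1-\gamma\ell|\}$. Moreover, this contraction rate is optimized (maximized over $\gamma$) at $\gamma^*=2/(m+\ell)$; (iii) if $\mathsf{F}(x)=Ax+b$ for all $x\in\mathbb{R}^n$, with $A=A^\top\succ0$, then for every $\gamma\in\,]1/\lambda_{\min}(A),+\infty[$, the dynamics $(\ast)$ are strongly infinitesimally contracting with respect to the norm $\|\cdot\|_{(\gamma A-I_n)}$ with rate $1$.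
   Context: $\mathsf{F}$ is strongly monotone with parameter $m>0$ if $(\mathsf{F}(x)-\mathsf{F}(y))^\top(x-y)\ge m\|x-y\|_2^2$ for all $x,y$. For $g$ convex, closed (closed epigraph) and proper (never $-\infty$ and finite somewhere), $\operatorname{prox}_{\gamma g}(x)=\operatorname{argmin}_{z\in\mathbb{R}^n}\,g(z)+\frac1{2\gamma}\|x-z\|_2^2$. For symmetric positive definite $P$, $\|x\|_P=\sqrt{x^\top Px}$, and $\|\cdot\|_2$ is the case $P=I_n$. Dynamics $\dot x=G(x)$ with $G:\mathbb{R}^n\to\mathbb{R}^n$ continuous are strongly infinitesimally contracting with respect to $\|\cdot\|_P$ with rate $c>0$ if $(G(x)-G(y))^\top P(x-y)\le -c\|x-y\|_P^2$ for all $x,y\in\mathbb{R}^n$. $\lambda_{\min}(A)$ is the smallest eigenvalue of $A$. *)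

theory Defs
  imports "HOL-Analysis.Analysis"
begin

definition strongly_monotone :: "real \<Rightarrow> ('a::real_inner \<Rightarrow> 'a) \<Rightarrow> bool" where
  "strongly_monotone m F \<longleftrightarrow> (\<forall>x y. (F x - F y) \<bullet> (x - y) \<ge> m * (norm (x - y))\<^sup>2)"

definition strongly_convex :: "real \<Rightarrow> ('a::real_inner \<Rightarrow> real) \<Rightarrow> bool" where
  "strongly_convex \<mu> f \<longleftrightarrow> 0 < \<mu> \<and> convex_on UNIV (\<lambda>x. f x - \<mu> / 2 * (norm x)\<^sup>2)"

(* The library's epigraph is restricted to real-valued functions; this is its
   analogue for extended-real-valued ones, still a subset of 'a \<times> real. *)
definition ext_epigraph :: "('a \<Rightarrow> ereal) \<Rightarrow> ('a \<times> real) set" where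
  "ext_epigraph g = {(x, t). g x \<le> ereal t}"

(* Convexity via the epigraph also makes sense where g takes infinite values. *)
definition convex_fun :: "('a::real_vector \<Rightarrow> ereal) \<Rightarrow> bool" where
  "convex_fun g \<longleftrightarrow> convex (ext_epigraph g)"

definition closed_fun :: "('a::topological_space \<Rightarrow> ereal) \<Rightarrow> bool" where
  "closed_fun g \<longleftrightarrow> closed (ext_epigraph g)"

definition proper_fun :: "('a \<Rightarrow> ereal) \<Rightarrow> bool" where
  "proper_fun g \<longleftrightarrow> (\<forall>x. g x \<noteq> -\<infinity>) \<and> (\<exists>x. \<bar>g x\<bar> \<noteq> \<infinity>)"

(* prox \<gamma> g is the operator prox_(\<gamma>g). The minimiser exists and is unique for
   \<gamma> > 0 and g convex, closed and proper; elsewhere the value is unspecified. *)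
definition prox :: "real \<Rightarrow> ('a::real_normed_vector \<Rightarrow> ereal) \<Rightarrow> 'a \<Rightarrow> 'a" where
  "prox \<gamma> g x = arg_min (\<lambda>z. g z + ereal (1 / (2 * \<gamma>) * (norm (x - z))\<^sup>2)) (\<lambda>_. True)"

definition prox_grad_field ::
  "real \<Rightarrow> ('a::real_normed_vector \<Rightarrow> ereal) \<Rightarrow> ('a \<Rightarrow> 'a) \<Rightarrow> 'a \<Rightarrow> 'a" where
  "prox_grad_field \<gamma> g F x = - x + prox \<gamma> g (x - \<gamma> *\<^sub>R F x)"

definition sym_pos_def :: "real^'n^'n \<Rightarrow> bool" where
  "sym_pos_def P \<longleftrightarrow> transpose P = P \<and> (\<forall>x. x \<noteq> 0 \<longrightarrow> 0 < x \<bullet> (P *v x))"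

definition norm_wrt :: "real^'n^'n \<Rightarrow> real^'n \<Rightarrow> real" where
  "norm_wrt P x = sqrt (x \<bullet> (P *v x))"

(* Contraction of the dynamics x' = G x with respect to norm_wrt P with rate c. The
   well-formedness conditions on G, P and c are part of the notion. *)
definition strongly_inf_contracting ::
  "(real^'n \<Rightarrow> real^'n) \<Rightarrow> real^'n^'n \<Rightarrow> real \<Rightarrow> bool" where
  "strongly_inf_contracting G P c \<longleftrightarrow>
     continuous_on UNIV G \<and> sym_pos_def P \<and> 0 < c \<and>
     (\<forall>x y. (G x - G y) \<bullet> (P *v (x - y)) \<le> - c * (norm_wrt P (x - y))\<^sup>2)"

(* Only real eigenvalues are considered, which for a symmetric matrix are all of them. *)
definition lambda_min :: "real^'n^'n \<Rightarrow> real" where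
  "lambda_min A = (LEAST \<mu>. \<exists>v. v \<noteq> 0 \<and> A *v v = \<mu> *\<^sub>R v)"

end

theory Submission
  imports Defs
begin

text \<open>
  Write \<open>T x = prox (x - \<gamma> F x)\<close>, so that the vector field is \<open>T - id\<close>. Everything about the
  proximal operator enters through one inequality, firm nonexpansiveness:
  \<open>\<parallel>prox u - prox v\<parallel>\<^sup>2 \<le> (prox u - prox v) \<bullet> (u - v)\<close> (\<open>prox_firmly_nonexpansive\<close>). It has two
  consequences: the operator is 1-Lipschitz, and it is monotone.

  The Lipschitz property gives the first two parts. If the forward step \<open>x - \<gamma> F x\<close> is
  \<open>q\<close>-Lipschitz, then so is \<open>T\<close>, and the Cauchy-Schwarz inequality yields
  \<open>(T x - T y - (x - y)) \<bullet> (x - y) \<le> - (1 - q) \<parallel>x - y\<parallel>\<^sup>2\<close> (\<open>prox_grad_field_contracting\<close>). It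
  remains to compute \<open>q\<close>. For a strongly monotone Lipschitz \<open>F\<close>, expanding the square does it
  (\<open>forward_step_lipschitz\<close>). For a gradient there is more information: \<open>F - m id\<close> is the
  gradient of a convex function with \<open>(l - m)\<close>-Lipschitz gradient and hence cocoercive by the
  Baillon-Haddad argument (\<open>gradient_cocoercive\<close>), which makes the forward step behave as if \<open>F\<close>
  were a symmetric linear map with spectrum in \<open>[m, l]\<close> (\<open>gradient_step_lipschitz\<close>).

  Monotonicity gives the last part. If \<open>F x = A x + b\<close>, then with \<open>P = \<gamma> A - I\<close> the forward step
  is \<open>- P x - \<gamma> b\<close>. Monotonicity of the proximal operator therefore says
  \<open>(T x - T y) \<bullet> P (x - y) \<le> 0\<close>, and the term \<open>- id\<close> of the vector field alone contributes
  \<open>- \<parallel>x - y\<parallel>\<close> squared in the norm of \<open>P\<close> (\<open>affine_prox_grad_field_contracting\<close>). That \<open>P\<close> is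
  positive definite for \<open>\<gamma> > 1 / \<lambda>\<^sub>m\<^sub>i\<^sub>n(A)\<close> is the Rayleigh bound \<open>lambda_min_symmetric\<close>.

  The optimal step sizes come from a square completion and from the crossing point of two lines
  (\<open>monotone_rate_optimal\<close>, \<open>gradient_rate_optimal\<close>).
\<close>

section \<open>Two elementary tools\<close>

text \<open>
  The conclusion of a variational argument: a perturbation of size \<open>s\<close> of a minimiser changes the
  objective by a nonnegative amount, so the first-order coefficient is nonnegative.
\<close>

lemma nonneg_of_first_order:
  fixes a b :: real
  assumes "\<And>s. 0 < s \<Longrightarrow> s \<le> 1 \<Longrightarrow> 0 \<le> s * a + s\<^sup>2 * b"
  shows "0 \<le> a"
proof (rule ccontr)
  assume "\<not> 0 \<le> a"
  define s where "s = min 1 (- a / (2 * (\<bar>b\<bar> + 1)))"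
  have s: "0 < s" "s \<le> 1"
    using divide_pos_pos[of "- a" "2 * (\<bar>b\<bar> + 1)"] \<open>\<not> 0 \<le> a\<close> by (simp_all add: s_def)
  have "s * (\<bar>b\<bar> + 1) \<le> - a / (2 * (\<bar>b\<bar> + 1)) * (\<bar>b\<bar> + 1)"
    by (intro mult_right_mono) (auto simp: s_def)
  also have "\<dots> = - a / 2"
    by (simp add: field_simps)
  finally have "s * (\<bar>b\<bar> + 1) \<le> - a / 2" .
  moreover have "s * b \<le> s * (\<bar>b\<bar> + 1)"
    using s by (intro mult_left_mono) auto
  ultimately have "a + s * b < 0"
    using \<open>\<not> 0 \<le> a\<close> by linarith
  then have "s * (a + s * b) < 0"
    using s by (simp add: mult_pos_neg)
  with assms[OF s] show False
    by (simp add: power2_eq_square algebra_simps)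
qed

lemma norm_diff_scaleR_sq:
  fixes a b :: "'a::real_inner"
  shows "(norm (a - s *\<^sub>R b))\<^sup>2 = (norm a)\<^sup>2 - 2 * s * (a \<bullet> b) + s\<^sup>2 * (norm b)\<^sup>2"
  unfolding power2_norm_eq_inner
  by (simp add: inner_commute power2_eq_square algebra_simps)

section \<open>The proximal operator\<close>

text \<open>
  Take a point of the graph with finite value and lower it by one. It leaves the epigraph, so a
  hyperplane separates it from the epigraph, and since the hyperplane passes strictly between two
  points on one vertical line, it is the graph of an affine function.
\<close>

lemma proper_convex_closed_affine_minorant:
  fixes g :: "'a::euclidean_space \<Rightarrow> ereal"
  assumes "convex_fun g" "closed_fun g" "proper_fun g"
  obtains u \<beta> where "\<And>z t. (z, t) \<in> ext_epigraph g \<Longrightarrow> u \<bullet> z + \<beta> \<le> t"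
proof -
  have "\<exists>z. \<bar>g z\<bar> \<noteq> \<infinity>"
    using assms(3) by (simp add: proper_fun_def)
  then obtain z0 where "\<bar>g z0\<bar> \<noteq> \<infinity>"
    by (rule exE)
  then obtain t0 where z0: "g z0 = ereal t0"
    by (cases "g z0") auto
  have "(z0, t0 - 1) \<notin> ext_epigraph g"
    by (simp add: ext_epigraph_def z0)
  then obtain a b where below: "a \<bullet> (z0, t0 - 1) < b"
      and above: "\<And>w. w \<in> ext_epigraph g \<Longrightarrow> b < a \<bullet> w"
    using separating_hyperplane_closed_point[of "ext_epigraph g" "(z0, t0 - 1)"] assms
    unfolding convex_fun_def closed_fun_def by blast
  obtain v s where a: "a = (v, s)" by fastforce
  have "b < a \<bullet> (z0, t0)"
    by (rule above) (simp add: ext_epigraph_def z0)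
  with below have s: "0 < s"
    by (simp add: a algebra_simps)
  show thesis
  proof (rule that[of "- (1 / s) *\<^sub>R v" "b / s"])
    fix z t assume "(z, t) \<in> ext_epigraph g"
    from above[OF this] show "(- (1 / s) *\<^sub>R v) \<bullet> z + b / s \<le> t"
      using s by (simp add: a field_simps)
  qed
qed

text \<open>
  The minimisation takes place over the epigraph, where the objective becomes the real-valued
  continuous function \<open>(z, t) \<mapsto> t + \<parallel>x - z\<parallel>\<^sup>2 / (2 \<gamma>)\<close>. An affine minorant of \<open>g\<close> is dominated by
  the quadratic term, so the sublevel sets are compact and the minimum is attained. This settles
  that the \<open>arg_min\<close> defining \<open>prox\<close> is a genuine minimiser with a finite value of \<open>g\<close>.
\<close>

lemma prox_minimizes:
  fixes g :: "'a::euclidean_space \<Rightarrow> ereal"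
  assumes g: "convex_fun g" "closed_fun g" "proper_fun g" and "0 < \<gamma>"
  obtains \<tau> where "g (prox \<gamma> g x) = ereal \<tau>"
    "\<And>z t. (z, t) \<in> ext_epigraph g \<Longrightarrow>
       \<tau> + 1 / (2 * \<gamma>) * (norm (x - prox \<gamma> g x))\<^sup>2 \<le> t + 1 / (2 * \<gamma>) * (norm (x - z))\<^sup>2"
proof -
  define k where "k = 1 / (2 * \<gamma>)"
  have k: "0 < k" using \<open>0 < \<gamma>\<close> by (simp add: k_def)
  define E where "E = ext_epigraph g"
  define \<phi> where "\<phi> = (\<lambda>(z, t). t + k * (norm (x - z))\<^sup>2)"
  have cont: "continuous_on A \<phi>" for A
    unfolding \<phi>_def case_prod_unfold by (intro continuous_intros)
  obtain u \<beta> where minorant: "\<And>z t. (z, t) \<in> E \<Longrightarrow> u \<bullet> z + \<beta> \<le> t"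
    using proper_convex_closed_affine_minorant[OF g] unfolding E_def by blast
  have "\<exists>z. \<bar>g z\<bar> \<noteq> \<infinity>"
    using g(3) by (simp add: proper_fun_def)
  then obtain z0 where "\<bar>g z0\<bar> \<noteq> \<infinity>"
    by (rule exE)
  then obtain t0 where z0: "g z0 = ereal t0"
    by (cases "g z0") auto
  have not_minf: "g z \<noteq> -\<infinity>" for z
    using g(3) by (simp add: proper_fun_def)
  define M where "M = \<phi> (z0, t0)"
  define S where "S = E \<inter> {w. \<phi> w \<le> M}"
  have "closed S"
    unfolding S_def using g(2) cont[of UNIV]
    by (intro closed_Int closed_Collect_le) (auto simp: E_def closed_fun_def)
  moreover have "bounded S"
  proof -
    \<comment> \<open>Completing the square in \<open>u \<bullet> z + k * (norm (x - z))\<^sup>2\<close> gives the centre \<open>c\<close> and the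
      squared radius \<open>C\<close> of a ball containing the sublevel set.\<close>
    define c where "c = x - (1 / (2 * k)) *\<^sub>R u"
    define C where "C = (M - \<beta> - u \<bullet> x + (norm u)\<^sup>2 / (4 * k)) / k"
    have "S \<subseteq> cball c (sqrt C) \<times> {\<beta> - norm u * (norm c + sqrt C) .. M}"
    proof
      fix w assume "w \<in> S"
      moreover obtain z t where w: "w = (z, t)" by fastforce
      ultimately have zt: "(z, t) \<in> E" "\<phi> (z, t) \<le> M"
        by (simp_all add: S_def)
      have shift: "c - z = (x - z) - (1 / (2 * k)) *\<^sub>R u"
        by (simp add: c_def)
      have "k * (norm (c - z))\<^sup>2 = k * (norm (x - z))\<^sup>2 + u \<bullet> z - u \<bullet> x + (norm u)\<^sup>2 / (4 * k)"
        unfolding shift norm_diff_scaleR_sq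
        using k by (simp add: inner_diff_right inner_commute field_simps power2_eq_square)
      also have "\<dots> \<le> k * C"
        using zt minorant[OF zt(1)] k by (simp add: \<phi>_def C_def)
      finally have "(norm (c - z))\<^sup>2 \<le> C"
        using k by simp
      then have dist: "dist c z \<le> sqrt C"
        by (simp add: dist_norm real_le_rsqrt)
      have "norm z \<le> norm c + norm (z - c)"
        by (rule norm_triangle_sub)
      also have "\<dots> \<le> norm c + sqrt C"
        using dist by (simp add: dist_norm norm_minus_commute)
      finally have "norm u * norm z \<le> norm u * (norm c + sqrt C)"
        by (intro mult_left_mono) auto
      moreover have "- (norm u * norm z) \<le> u \<bullet> z"
        using Cauchy_Schwarz_ineq2[of u z] by linarith
      ultimately have "\<beta> - norm u * (norm c + sqrt C) \<le> t"
        using minorant[OF zt(1)] by linarith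
      moreover have "0 \<le> k * (norm (x - z))\<^sup>2" using k by simp
      then have "t \<le> M"
        using zt(2) by (simp add: \<phi>_def)
      ultimately show "w \<in> cball c (sqrt C) \<times> {\<beta> - norm u * (norm c + sqrt C) .. M}"
        using dist by (simp add: w)
    qed
    then show ?thesis
      by (rule bounded_subset[rotated]) (intro bounded_Times bounded_cball bounded_closed_interval)
  qed
  ultimately have "compact S"
    by (simp add: compact_eq_bounded_closed)
  moreover have "(z0, t0) \<in> S"
    by (simp add: S_def E_def M_def ext_epigraph_def z0)
  ultimately obtain w where w: "w \<in> S" "\<And>w'. w' \<in> S \<Longrightarrow> \<phi> w \<le> \<phi> w'"
    using continuous_attains_inf[OF _ _ cont, of S] by blast
  have w_min: "\<phi> w \<le> \<phi> w'" if "w' \<in> E" for w'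
    using w that by (cases "\<phi> w' \<le> M") (auto simp: S_def intro: order_trans)
  define \<Phi> where "\<Phi> = (\<lambda>z. g z + ereal (k * (norm (x - z))\<^sup>2))"
  obtain q \<sigma> where q: "w = (q, \<sigma>)" by fastforce
  have "\<Phi> q \<le> ereal (\<phi> w)"
    using w(1) unfolding S_def E_def ext_epigraph_def q
    by (auto simp: \<Phi>_def \<phi>_def simp flip: plus_ereal.simps(1) intro!: add_right_mono)
  moreover have "ereal (\<phi> w) \<le> \<Phi> z" for z
  proof (cases "g z")
    case (real t)
    then show ?thesis
      using w_min[of "(z, t)"] by (simp add: E_def ext_epigraph_def \<Phi>_def \<phi>_def q)
  qed (use not_minf in \<open>auto simp: \<Phi>_def\<close>)
  ultimately have "is_arg_min \<Phi> (\<lambda>_. True) q"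
    unfolding is_arg_min_def by (meson leD order_trans)
  then have "is_arg_min \<Phi> (\<lambda>_. True) (arg_min \<Phi> (\<lambda>_. True))"
    unfolding arg_min_def by (rule someI)
  moreover have "prox \<gamma> g x = arg_min \<Phi> (\<lambda>_. True)"
    by (simp add: prox_def \<Phi>_def k_def)
  ultimately have p_min: "\<Phi> (prox \<gamma> g x) \<le> \<Phi> z" for z
    unfolding is_arg_min_def by (auto simp: not_less)
  from p_min[of z0] obtain \<tau> where \<tau>: "g (prox \<gamma> g x) = ereal \<tau>"
    using not_minf[of "prox \<gamma> g x"] by (cases "g (prox \<gamma> g x)") (auto simp: \<Phi>_def z0)
  show thesis
  proof (rule that[OF \<tau>])
    fix z t assume zt: "(z, t) \<in> ext_epigraph g"
    have "\<Phi> z \<le> ereal (t + k * (norm (x - z))\<^sup>2)"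
      using zt by (auto simp: ext_epigraph_def \<Phi>_def simp flip: plus_ereal.simps(1) intro!: add_right_mono)
    with p_min[of z] have "\<Phi> (prox \<gamma> g x) \<le> ereal (t + k * (norm (x - z))\<^sup>2)"
      by (rule order_trans)
    then show "\<tau> + 1 / (2 * \<gamma>) * (norm (x - prox \<gamma> g x))\<^sup>2 \<le> t + 1 / (2 * \<gamma>) * (norm (x - z))\<^sup>2"
      by (simp add: \<Phi>_def \<tau> k_def)
  qed
qed

text \<open>
  Moving from the minimiser \<open>p\<close> towards a point \<open>z\<close> stays in the epigraph by convexity and cannot
  decrease the objective; the first-order term of this statement says that \<open>(x - p) / \<gamma>\<close> is a
  subgradient of \<open>g\<close> at \<open>p\<close>.
\<close>

lemma prox_variational_inequality:
  fixes g :: "'a::euclidean_space \<Rightarrow> ereal"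
  assumes g: "convex_fun g" "closed_fun g" "proper_fun g" and "0 < \<gamma>"
  obtains \<tau> where "g (prox \<gamma> g x) = ereal \<tau>"
    "\<And>z t. (z, t) \<in> ext_epigraph g \<Longrightarrow> (x - prox \<gamma> g x) \<bullet> (z - prox \<gamma> g x) \<le> \<gamma> * (t - \<tau>)"
proof -
  define p where "p = prox \<gamma> g x"
  define k where "k = 1 / (2 * \<gamma>)"
  obtain \<tau> where \<tau>: "g p = ereal \<tau>"
    and min: "\<And>z t. (z, t) \<in> ext_epigraph g \<Longrightarrow>
       \<tau> + k * (norm (x - p))\<^sup>2 \<le> t + k * (norm (x - z))\<^sup>2"
    using prox_minimizes[OF assms] unfolding p_def k_def by metis
  have "(x - p) \<bullet> (z - p) \<le> \<gamma> * (t - \<tau>)" if zt: "(z, t) \<in> ext_epigraph g" for z t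
  proof -
    have "0 \<le> (t - \<tau>) - 2 * k * ((x - p) \<bullet> (z - p))"
    proof (rule nonneg_of_first_order)
      fix s :: real assume s: "0 < s" "s \<le> 1"
      have "(1 - s) *\<^sub>R (p, \<tau>) + s *\<^sub>R (z, t) \<in> ext_epigraph g"
        using g(1) zt s unfolding convex_fun_def
        by (intro convexD) (auto simp: ext_epigraph_def \<tau>)
      then have "(p + s *\<^sub>R (z - p), \<tau> + s * (t - \<tau>)) \<in> ext_epigraph g"
        by (simp add: algebra_simps)
      from min[OF this]
      have "k * (norm (x - p))\<^sup>2 \<le> s * (t - \<tau>) + k * (norm ((x - p) - s *\<^sub>R (z - p)))\<^sup>2"
        by (simp add: algebra_simps)
      also have "(norm ((x - p) - s *\<^sub>R (z - p)))\<^sup>2 =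
          (norm (x - p))\<^sup>2 - 2 * s * ((x - p) \<bullet> (z - p)) + s\<^sup>2 * (norm (z - p))\<^sup>2"
        by (rule norm_diff_scaleR_sq)
      finally show "0 \<le> s * (t - \<tau> - 2 * k * ((x - p) \<bullet> (z - p))) + s\<^sup>2 * (k * (norm (z - p))\<^sup>2)"
        by (simp add: algebra_simps)
    qed
    then show ?thesis
      using \<open>0 < \<gamma>\<close> by (simp add: k_def field_simps)
  qed
  with \<tau> show thesis
    unfolding p_def by (rule that)
qed

text \<open>
  Subgradients are monotone: adding the two variational inequalities, each tested at the other
  minimiser, cancels the values of \<open>g\<close>.
\<close>

lemma prox_firmly_nonexpansive:
  fixes g :: "'a::euclidean_space \<Rightarrow> ereal"
  assumes g: "convex_fun g" "closed_fun g" "proper_fun g" and "0 < \<gamma>"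
  shows "(norm (prox \<gamma> g x - prox \<gamma> g y))\<^sup>2 \<le> (prox \<gamma> g x - prox \<gamma> g y) \<bullet> (x - y)"
proof -
  define p q where "p = prox \<gamma> g x" and "q = prox \<gamma> g y"
  obtain \<sigma> where \<sigma>: "g p = ereal \<sigma>"
    and vi_p: "\<And>z t. (z, t) \<in> ext_epigraph g \<Longrightarrow> (x - p) \<bullet> (z - p) \<le> \<gamma> * (t - \<sigma>)"
    using prox_variational_inequality[OF assms] unfolding p_def by metis
  obtain \<tau> where \<tau>: "g q = ereal \<tau>"
    and vi_q: "\<And>z t. (z, t) \<in> ext_epigraph g \<Longrightarrow> (y - q) \<bullet> (z - q) \<le> \<gamma> * (t - \<tau>)"
    using prox_variational_inequality[OF assms] unfolding q_def by metis
  have "(x - p) \<bullet> (q - p) + (y - q) \<bullet> (p - q) \<le> \<gamma> * (\<tau> - \<sigma>) + \<gamma> * (\<sigma> - \<tau>)"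
    by (intro add_mono vi_p vi_q) (simp_all add: ext_epigraph_def \<sigma> \<tau>)
  also have "\<dots> = 0"
    by (simp add: algebra_simps)
  finally show ?thesis
    unfolding p_def[symmetric] q_def[symmetric] power2_norm_eq_inner
    by (simp add: inner_diff_left inner_diff_right inner_commute)
qed

lemma prox_nonexpansive:
  fixes g :: "'a::euclidean_space \<Rightarrow> ereal"
  assumes "convex_fun g" "closed_fun g" "proper_fun g" and "0 < \<gamma>"
  shows "1-lipschitz_on UNIV (prox \<gamma> g)"
proof (rule lipschitz_onI)
  fix x y
  let ?d = "prox \<gamma> g x - prox \<gamma> g y"
  have "norm ?d * norm ?d \<le> norm ?d * norm (x - y)"
    using prox_firmly_nonexpansive[OF assms, of x y] norm_cauchy_schwarz[of ?d "x - y"]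
    by (simp add: power2_eq_square)
  then show "dist (prox \<gamma> g x) (prox \<gamma> g y) \<le> 1 * dist x y"
    by (cases "norm ?d = 0") (simp_all add: dist_norm)
qed simp

section \<open>From a Lipschitz forward step to contraction\<close>

lemma sym_pos_def_mat_1: "sym_pos_def (mat 1)"
  by (simp add: sym_pos_def_def transpose_mat)

lemma norm_wrt_sq:
  assumes "sym_pos_def P"
  shows "(norm_wrt P x)\<^sup>2 = x \<bullet> (P *v x)"
  using assms unfolding norm_wrt_def sym_pos_def_def
  by (cases "x = 0") (auto simp: less_imp_le)

lemma prox_grad_field_contracting:
  fixes F :: "real^'n \<Rightarrow> real^'n" and g :: "real^'n \<Rightarrow> ereal"
  assumes g: "convex_fun g" "closed_fun g" "proper_fun g" and "0 < \<gamma>"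
    and step: "q-lipschitz_on UNIV (\<lambda>x. x - \<gamma> *\<^sub>R F x)" and "q < 1"
  shows "strongly_inf_contracting (prox_grad_field \<gamma> g F) (mat 1) (1 - q)"
proof -
  let ?T = "\<lambda>x. prox \<gamma> g (x - \<gamma> *\<^sub>R F x)"
  have T: "q-lipschitz_on UNIV ?T"
    using lipschitz_on_compose[OF step lipschitz_on_subset[OF prox_nonexpansive[OF g \<open>0 < \<gamma>\<close>]]]
    by (simp add: o_def)
  have "(prox_grad_field \<gamma> g F x - prox_grad_field \<gamma> g F y) \<bullet> (x - y)
      \<le> - (1 - q) * (norm (x - y))\<^sup>2" for x y
  proof -
    have "(?T x - ?T y) \<bullet> (x - y) \<le> norm (?T x - ?T y) * norm (x - y)"
      by (rule norm_cauchy_schwarz)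
    also have "\<dots> \<le> (q * norm (x - y)) * norm (x - y)"
      using lipschitz_onD[OF T, of x y] by (intro mult_right_mono) (simp_all add: dist_norm)
    finally have "(?T x - ?T y) \<bullet> (x - y) \<le> q * (norm (x - y))\<^sup>2"
      by (simp add: power2_eq_square)
    moreover have "(prox_grad_field \<gamma> g F x - prox_grad_field \<gamma> g F y) \<bullet> (x - y)
        = (?T x - ?T y) \<bullet> (x - y) - (norm (x - y))\<^sup>2"
      by (simp add: prox_grad_field_def power2_norm_eq_inner algebra_simps)
    ultimately show ?thesis
      by (simp add: left_diff_distrib)
  qed
  moreover have "continuous_on UNIV (prox_grad_field \<gamma> g F)"
    unfolding prox_grad_field_def
    by (intro continuous_intros lipschitz_on_continuous_on[OF T])
  ultimately show ?thesis
    using \<open>q < 1\<close> unfolding strongly_inf_contracting_def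
    by (simp add: sym_pos_def_mat_1 norm_wrt_sq power2_norm_eq_inner)
qed

text \<open>
  Compare the two bounds along any unit vector; such a vector exists since a Euclidean space has
  positive dimension.
\<close>

lemma strongly_monotone_lipschitz_le:
  fixes F :: "'a::euclidean_space \<Rightarrow> 'a"
  assumes "strongly_monotone m F" and "l-lipschitz_on UNIV F"
  shows "m \<le> l"
proof -
  obtain e :: 'a where e: "norm e = 1"
    using vector_choose_size[of 1] by auto
  have "m \<le> (F e - F 0) \<bullet> e"
    using assms(1) e unfolding strongly_monotone_def by (metis diff_zero mult.right_neutral one_power2)
  also have "\<dots> \<le> norm (F e - F 0)"
    using norm_cauchy_schwarz[of "F e - F 0" e] e by simp
  also have "\<dots> \<le> l"
    using lipschitz_onD[OF assms(2), of e 0] e by (simp add: dist_norm)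
  finally show ?thesis .
qed

lemma forward_step_lipschitz:
  fixes F :: "'a::real_inner \<Rightarrow> 'a"
  assumes mono: "strongly_monotone m F" and lip: "l-lipschitz_on UNIV F" and "0 \<le> \<gamma>" 
    and nonneg: "0 \<le> 1 - 2 * \<gamma> * m + \<gamma>\<^sup>2 * l\<^sup>2"
  shows "(sqrt (1 - 2 * \<gamma> * m + \<gamma>\<^sup>2 * l\<^sup>2))-lipschitz_on UNIV (\<lambda>x. x - \<gamma> *\<^sub>R F x)"
proof (rule lipschitz_onI)
  fix x y
  define d h where "d = x - y" and "h = F x - F y"
  have "norm h \<le> l * norm d"
    using lipschitz_onD[OF lip, of x y] by (simp add: d_def h_def dist_norm)
  then have h: "(norm h)\<^sup>2 \<le> l\<^sup>2 * (norm d)\<^sup>2"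
    by (metis norm_ge_zero power_mono power_mult_distrib)
  have hd: "m * (norm d)\<^sup>2 \<le> h \<bullet> d"
    using mono by (simp add: strongly_monotone_def d_def h_def)
  have "(norm (d - \<gamma> *\<^sub>R h))\<^sup>2 = (norm d)\<^sup>2 - 2 * \<gamma> * (h \<bullet> d) + \<gamma>\<^sup>2 * (norm h)\<^sup>2"
    by (simp add: norm_diff_scaleR_sq inner_commute)
  also have "\<dots> \<le> (norm d)\<^sup>2 - 2 * \<gamma> * (m * (norm d)\<^sup>2) + \<gamma>\<^sup>2 * (l\<^sup>2 * (norm d)\<^sup>2)"
    using h hd \<open>0 \<le> \<gamma>\<close> by (intro add_mono diff_mono mult_left_mono) auto
  also have "\<dots> = (sqrt (1 - 2 * \<gamma> * m + \<gamma>\<^sup>2 * l\<^sup>2) * norm d)\<^sup>2"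
    using nonneg by (simp add: power_mult_distrib algebra_simps)
  finally have "norm (d - \<gamma> *\<^sub>R h) \<le> sqrt (1 - 2 * \<gamma> * m + \<gamma>\<^sup>2 * l\<^sup>2) * norm d"
    by (rule power2_le_imp_le) (use nonneg in simp)
  then show "dist (x - \<gamma> *\<^sub>R F x) (y - \<gamma> *\<^sub>R F y) \<le> sqrt (1 - 2 * \<gamma> * m + \<gamma>\<^sup>2 * l\<^sup>2) * dist x y"
    by (simp add: dist_norm d_def h_def algebra_simps)
qed (use nonneg in simp)

section \<open>The forward step for gradients\<close>

text \<open>
  The descent lemma under a one-sided bound. Since \<open>L\<close> may have any sign, applying the lemma to
  \<open>- f\<close> with \<open>L = 0\<close> turns monotonicity of the gradient into the tangent inequality of a convex
  function.
\<close>

lemma gradient_upper_bound: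
  fixes f :: "'a::real_inner \<Rightarrow> real"
  assumes grad: "\<And>x. GDERIV f x :> H x"
    and upper: "\<And>x y. (H x - H y) \<bullet> (x - y) \<le> L * (norm (x - y))\<^sup>2"
  shows "f y \<le> f x + H x \<bullet> (y - x) + L / 2 * (norm (y - x))\<^sup>2"
proof -
  define d where "d = y - x"
  define \<phi> where "\<phi> t = f (x + t *\<^sub>R d) - t * (H x \<bullet> d) - L / 2 * t\<^sup>2 * (norm d)\<^sup>2" for t
  \<comment> \<open>The derivative of \<open>\<phi>\<close> vanishes at \<open>0\<close>, and at \<open>t > 0\<close> it is nonpositive by the assumed bound for the pair
    \<open>x + t *\<^sub>R d\<close>, \<open>x\<close>, divided by \<open>t\<close>.\<close>
  have "\<phi> 1 \<le> \<phi> 0"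
  proof (rule DERIV_nonpos_imp_nonincreasing[of 0 1 \<phi>])
    fix t :: real assume t: "0 \<le> t"
    have "((\<lambda>t. f (x + t *\<^sub>R d)) has_derivative (\<lambda>s. (s *\<^sub>R d) \<bullet> H (x + t *\<^sub>R d))) (at t)"
      using grad[of "x + t *\<^sub>R d"] unfolding gderiv_def
      by (rule has_derivative_compose[rotated]) (auto intro!: derivative_eq_intros)
    then have "((\<lambda>t. f (x + t *\<^sub>R d)) has_real_derivative H (x + t *\<^sub>R d) \<bullet> d) (at t)"
      by (rule has_derivative_imp_has_field_derivative) (simp add: inner_commute)
    then have "(\<phi> has_real_derivative (H (x + t *\<^sub>R d) - H x) \<bullet> d - L * t * (norm d)\<^sup>2) (at t)"
      unfolding \<phi>_def by (auto intro!: derivative_eq_intros simp: inner_diff_left)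
    moreover have "(H (x + t *\<^sub>R d) - H x) \<bullet> d - L * t * (norm d)\<^sup>2 \<le> 0"
    proof (cases "t = 0")
      case False
      with t have "0 < t" by simp
      have "t * ((H (x + t *\<^sub>R d) - H x) \<bullet> d) \<le> t * (L * t * (norm d)\<^sup>2)"
        using upper[of "x + t *\<^sub>R d" x] by (simp add: power_mult_distrib power2_eq_square mult_ac)
      with \<open>0 < t\<close> show ?thesis by simp
    qed simp
    ultimately show "\<exists>D. DERIV \<phi> t :> D \<and> D \<le> 0" by blast
  qed simp
  then show ?thesis
    by (simp add: \<phi>_def d_def)
qed

text \<open>
  The Baillon-Haddad inequality. The tangent of \<open>f\<close> at \<open>y\<close> lies below \<open>f\<close>, which lies below its
  quadratic upper model at \<open>x\<close>. Evaluating both at a gradient step \<open>z\<close> from \<open>x\<close>, where the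
  difference of the two models is smallest, quantifies the gap between \<open>f x\<close> and the tangent
  value; adding the two gaps for \<open>(x, y)\<close> and \<open>(y, x)\<close> removes the values of \<open>f\<close>.
\<close>

lemma gradient_cocoercive:
  fixes f :: "'a::real_inner \<Rightarrow> real"
  assumes grad: "\<And>x. GDERIV f x :> H x"
    and mono: "\<And>x y. 0 \<le> (H x - H y) \<bullet> (x - y)"
    and upper: "\<And>x y. (H x - H y) \<bullet> (x - y) \<le> L * (norm (x - y))\<^sup>2" and "0 < L"
  shows "(norm (H x - H y))\<^sup>2 \<le> L * ((H x - H y) \<bullet> (x - y))"
proof -
  have lower: "f x + H x \<bullet> (y - x) \<le> f y" for x y
    using gradient_upper_bound[of "\<lambda>x. - f x" "\<lambda>x. - H x" 0 y x] grad mono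
    by (simp add: gderiv_def has_derivative_minus inner_diff_left algebra_simps)
  have gap: "f y + H y \<bullet> (x - y) + (norm (H x - H y))\<^sup>2 / (2 * L) \<le> f x" for x y
  proof -
    define h where "h = H x - H y"
    define z where "z = x - (1 / L) *\<^sub>R h"
    have "f y + H y \<bullet> (z - y) \<le> f x + H x \<bullet> (z - x) + L / 2 * (norm (z - x))\<^sup>2"
      using lower[of y z] gradient_upper_bound[OF grad upper, of z x] by linarith
    moreover have "L / 2 * (norm (z - x))\<^sup>2 = (norm h)\<^sup>2 / (2 * L)"
      using \<open>0 < L\<close> by (simp add: z_def power_divide power2_eq_square)
    moreover have "H y \<bullet> (z - y) = H y \<bullet> (x - y) - (H y \<bullet> h) / L"
      by (simp add: z_def inner_diff_right)
    moreover have "H x \<bullet> (z - x) = - (H x \<bullet> h) / L"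
      by (simp add: z_def)
    moreover have "(H x \<bullet> h) / L - (H y \<bullet> h) / L = (norm h)\<^sup>2 / L"
      by (simp add: h_def power2_norm_eq_inner inner_diff_left diff_divide_distrib)
    moreover have "(norm h)\<^sup>2 / L = 2 * ((norm h)\<^sup>2 / (2 * L))"
      by simp
    ultimately show ?thesis unfolding h_def[symmetric] by linarith
  qed
  have "(norm (H x - H y))\<^sup>2 / L \<le> (H x - H y) \<bullet> (x - y)"
    using gap[of x y] gap[of y x] norm_minus_commute[of "H x" "H y"]
    by (simp add: inner_diff_left inner_diff_right)
  then show ?thesis
    using \<open>0 < L\<close> by (simp add: field_simps)
qed

text \<open>
  Split \<open>F = H + m id\<close> and let \<open>d = x - y\<close>, \<open>h = H x - H y\<close>, so that the forward step maps \<open>d\<close> to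
  \<open>(1 - \<gamma> m) d - \<gamma> h\<close>. Cocoercivity of \<open>H\<close> bounds the squared norm of the latter by an expression
  that is affine in \<open>h \<bullet> d\<close>, a number in the interval from \<open>0\<close> to \<open>(l - m) \<parallel>d\<parallel>\<^sup>2\<close>. An affine
  function is largest at an endpoint, and the two endpoints produce the two entries of the maximum.
\<close>

lemma gradient_step_lipschitz:
  fixes F :: "'a::real_inner \<Rightarrow> 'a"
  assumes grad: "\<And>x. GDERIV f x :> F x"
    and mono: "strongly_monotone m F" and lip: "l-lipschitz_on UNIV F" and "m \<le> l" "0 \<le> \<gamma>"
  shows "(max \<bar>1 - \<gamma> * m\<bar> \<bar>1 - \<gamma> * l\<bar>)-lipschitz_on UNIV (\<lambda>x. x - \<gamma> *\<^sub>R F x)"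
proof (rule lipschitz_onI)
  fix x y
  define H where "H x = F x - m *\<^sub>R x" for x
  define d h where "d = x - y" and "h = H x - H y"
  have gradH: "GDERIV (\<lambda>x. f x - m / 2 * (x \<bullet> x)) x :> H x" for x
    using grad[of x] unfolding gderiv_def H_def
    by (auto intro!: derivative_eq_intros simp: inner_diff_right inner_commute)
  have H_diff: "(H x - H y) \<bullet> (x - y) = (F x - F y) \<bullet> (x - y) - m * (norm (x - y))\<^sup>2" for x y
    by (simp add: H_def power2_norm_eq_inner inner_diff_left inner_diff_right algebra_simps)
  have lowerH: "0 \<le> (H x - H y) \<bullet> (x - y)" for x y
    using mono by (simp add: H_diff strongly_monotone_def)
  have upperH: "(H x - H y) \<bullet> (x - y) \<le> (l - m) * (norm (x - y))\<^sup>2" for x y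
  proof -
    have "(F x - F y) \<bullet> (x - y) \<le> norm (F x - F y) * norm (x - y)"
      by (rule norm_cauchy_schwarz)
    also have "\<dots> \<le> (l * norm (x - y)) * norm (x - y)"
      using lipschitz_onD[OF lip, of x y] by (intro mult_right_mono) (simp_all add: dist_norm)
    finally show ?thesis
      using H_diff[of x y] by (simp add: power2_eq_square left_diff_distrib mult.assoc)
  qed
  have hd: "0 \<le> h \<bullet> d" "h \<bullet> d \<le> (l - m) * (norm d)\<^sup>2"
    using lowerH upperH by (simp_all add: h_def d_def)
  have coco: "(norm h)\<^sup>2 \<le> (l - m) * (h \<bullet> d)"
  \<comment> \<open>Cocoercivity needs a positive constant; for \<open>m = l\<close>, where \<open>h \<bullet> d = 0\<close>, the constant
    \<open>1\<close> already forces \<open>h = 0\<close>.\<close>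
  proof (cases "m = l")
    case True
    have "(norm h)\<^sup>2 \<le> 1 * (h \<bullet> d)"
      unfolding h_def d_def
    proof (rule gradient_cocoercive[OF gradH lowerH])
      show "(H x - H y) \<bullet> (x - y) \<le> 1 * (norm (x - y))\<^sup>2" for x y
        using upperH[of x y] True by (simp add: order_trans[OF _ zero_le_power2])
    qed simp
    with hd True show ?thesis by simp
  next
    case False
    with \<open>m \<le> l\<close> show ?thesis
      unfolding h_def d_def by (intro gradient_cocoercive[OF gradH lowerH upperH]) simp
  qed
  define c where "c = \<gamma>\<^sup>2 * (l - m) - 2 * \<gamma> * (1 - \<gamma> * m)"
  have "(norm ((1 - \<gamma> * m) *\<^sub>R d - \<gamma> *\<^sub>R h))\<^sup>2
      = (1 - \<gamma> * m)\<^sup>2 * (norm d)\<^sup>2 - 2 * \<gamma> * (1 - \<gamma> * m) * (h \<bullet> d) + \<gamma>\<^sup>2 * (norm h)\<^sup>2"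
    by (simp add: norm_diff_scaleR_sq inner_commute power_mult_distrib)
  also have "\<dots> \<le> (1 - \<gamma> * m)\<^sup>2 * (norm d)\<^sup>2 - 2 * \<gamma> * (1 - \<gamma> * m) * (h \<bullet> d) + \<gamma>\<^sup>2 * ((l - m) * (h \<bullet> d))"
    by (intro add_left_mono mult_left_mono coco) simp
  also have "\<dots> = (1 - \<gamma> * m)\<^sup>2 * (norm d)\<^sup>2 + c * (h \<bullet> d)"
    by (simp add: c_def algebra_simps)
  also have "\<dots> \<le> (max \<bar>1 - \<gamma> * m\<bar> \<bar>1 - \<gamma> * l\<bar>)\<^sup>2 * (norm d)\<^sup>2"
  proof (cases "c \<le> 0")
    case True
    then have "(1 - \<gamma> * m)\<^sup>2 * (norm d)\<^sup>2 + c * (h \<bullet> d) \<le> \<bar>1 - \<gamma> * m\<bar>\<^sup>2 * (norm d)\<^sup>2"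
      using hd by (simp add: mult_nonpos_nonneg)
    also have "\<dots> \<le> (max \<bar>1 - \<gamma> * m\<bar> \<bar>1 - \<gamma> * l\<bar>)\<^sup>2 * (norm d)\<^sup>2"
      by (intro mult_right_mono power_mono) auto
    finally show ?thesis .
  next
    case False
    then have "(1 - \<gamma> * m)\<^sup>2 * (norm d)\<^sup>2 + c * (h \<bullet> d)
        \<le> (1 - \<gamma> * m)\<^sup>2 * (norm d)\<^sup>2 + c * ((l - m) * (norm d)\<^sup>2)"
      using hd by (intro add_left_mono mult_left_mono) auto
    also have "\<dots> = \<bar>1 - \<gamma> * l\<bar>\<^sup>2 * (norm d)\<^sup>2"
      by (simp add: c_def power2_eq_square algebra_simps)
    also have "\<dots> \<le> (max \<bar>1 - \<gamma> * m\<bar> \<bar>1 - \<gamma> * l\<bar>)\<^sup>2 * (norm d)\<^sup>2"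
      by (intro mult_right_mono power_mono) auto
    finally show ?thesis .
  qed
  finally have "norm ((1 - \<gamma> * m) *\<^sub>R d - \<gamma> *\<^sub>R h) \<le> max \<bar>1 - \<gamma> * m\<bar> \<bar>1 - \<gamma> * l\<bar> * norm d"
    unfolding power_mult_distrib[symmetric] by (rule power2_le_imp_le) (simp add: le_max_iff_disj)
  moreover have "(1 - \<gamma> * m) *\<^sub>R d - \<gamma> *\<^sub>R h = (x - \<gamma> *\<^sub>R F x) - (y - \<gamma> *\<^sub>R F y)"
    by (simp add: h_def d_def H_def algebra_simps)
  ultimately show "dist (x - \<gamma> *\<^sub>R F x) (y - \<gamma> *\<^sub>R F y) \<le> max \<bar>1 - \<gamma> * m\<bar> \<bar>1 - \<gamma> * l\<bar> * dist x y"
    by (simp add: dist_norm d_def)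
qed (simp add: le_max_iff_disj)

section \<open>The smallest eigenvalue of a symmetric matrix\<close>

lemma symmetric_inner_swap:
  fixes A :: "real^'n^'n"
  assumes "transpose A = A"
  shows "x \<bullet> (A *v y) = y \<bullet> (A *v x)"
  by (metis assms dot_lmul_matrix inner_commute transpose_matrix_vector)

text \<open>
  A zero of a nonnegative quadratic form is a minimiser of the form, so the gradient \<open>2 B v\<close>
  vanishes there; the perturbation used is a step in the direction of the negative gradient.
\<close>

lemma pos_semidef_kernel:
  fixes B :: "real^'n^'n"
  assumes sym: "transpose B = B" and psd: "\<And>x. 0 \<le> x \<bullet> (B *v x)" and v: "v \<bullet> (B *v v) = 0"
  shows "B *v v = 0"
proof -
  define w where "w = B *v v"
  have "0 \<le> - 2 * (w \<bullet> w)"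
  proof (rule nonneg_of_first_order)
    fix s :: real
    have "0 \<le> (v - s *\<^sub>R w) \<bullet> (B *v (v - s *\<^sub>R w))" by (rule psd)
    also have "\<dots> = s * (- 2 * (w \<bullet> w)) + s\<^sup>2 * (w \<bullet> (B *v w))"
      using v symmetric_inner_swap[OF sym, of v w]
      by (simp add: w_def matrix_vector_mult_diff_distrib matrix_vector_mult_scaleR
          power2_eq_square algebra_simps)
    finally show "0 \<le> s * (- 2 * (w \<bullet> w)) + s\<^sup>2 * (w \<bullet> (B *v w))" .
  qed
  then have "(norm w)\<^sup>2 \<le> 0"
    by (simp add: power2_norm_eq_inner)
  then show ?thesis
    by (simp add: w_def)
qed

text \<open>
  The form \<open>x \<bullet> (A x)\<close> attains its minimum over the compact unit sphere, and after subtracting this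
  minimum the matrix is positive semidefinite and vanishes on the minimiser, which is therefore an
  eigenvector. In particular the least eigenvalue in the definition of \<open>lambda_min\<close> exists.
\<close>

lemma lambda_min_symmetric:
  fixes A :: "real^'n^'n"
  assumes sym: "transpose A = A"
  obtains v where "v \<noteq> 0" "A *v v = lambda_min A *\<^sub>R v"
    "\<And>x. lambda_min A * (norm x)\<^sup>2 \<le> x \<bullet> (A *v x)"
proof -
  define Q where "Q x = x \<bullet> (A *v x)" for x
  have "continuous_on (sphere 0 1) Q"
    unfolding Q_def by (intro continuous_intros matrix_vector_mult_linear_continuous_on)
  then obtain v where v: "v \<in> sphere 0 1" and v_min: "\<And>x. x \<in> sphere 0 1 \<Longrightarrow> Q v \<le> Q x"
    using continuous_attains_inf[of "sphere 0 1" Q] by auto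
  have rayleigh: "Q v * (norm x)\<^sup>2 \<le> Q x" for x
  proof (cases "x = 0")
    case False
    then have "Q v \<le> Q ((1 / norm x) *\<^sub>R x)"
      by (intro v_min) simp
    also have "\<dots> = Q x / (norm x)\<^sup>2"
      by (simp add: Q_def matrix_vector_mult_scaleR power2_eq_square)
    finally show ?thesis
      using False by (simp add: field_simps)
  qed (simp add: Q_def)
  define B where "B = A - Q v *\<^sub>R mat 1"
  have B: "B *v x = A *v x - Q v *\<^sub>R x" for x
    by (simp add: B_def matrix_vector_mult_diff_rdistrib scaleR_matrix_vector_assoc[symmetric])
  have "B *v v = 0"
  proof (rule pos_semidef_kernel)
    show "transpose B = B"
      using sym by (simp add: B_def transpose_def mat_def vec_eq_iff)
    show "0 \<le> x \<bullet> (B *v x)" for x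
      using rayleigh[of x] by (simp add: B Q_def inner_diff_right power2_norm_eq_inner)
    show "v \<bullet> (B *v v) = 0"
      using v by (simp add: B inner_diff_right Q_def flip: power2_norm_eq_inner)
  qed
  then have eig: "A *v v = Q v *\<^sub>R v" by (simp add: B)
  have "v \<noteq> 0" using v by auto
  have "lambda_min A = Q v"
    unfolding lambda_min_def
  proof (rule Least_equality)
    show "\<exists>w. w \<noteq> 0 \<and> A *v w = Q v *\<^sub>R w" using eig \<open>v \<noteq> 0\<close> by blast
    fix \<mu> assume "\<exists>w. w \<noteq> 0 \<and> A *v w = \<mu> *\<^sub>R w"
    then obtain w where w: "w \<noteq> 0" "A *v w = \<mu> *\<^sub>R w" by blast
    with rayleigh[of w] show "Q v \<le> \<mu>"
      by (simp add: Q_def power2_norm_eq_inner)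
  qed
  with eig \<open>v \<noteq> 0\<close> rayleigh show thesis
    by (intro that) (simp_all add: Q_def)
qed

lemma sym_pos_def_lambda_min_pos:
  assumes "sym_pos_def A"
  shows "0 < lambda_min A"
proof -
  have sym: "transpose A = A" and pos: "\<And>x. x \<noteq> 0 \<Longrightarrow> 0 < x \<bullet> (A *v x)"
    using assms by (simp_all add: sym_pos_def_def)
  obtain v where v: "v \<noteq> 0" "A *v v = lambda_min A *\<^sub>R v"
    using lambda_min_symmetric[OF sym] by metis
  have "0 < lambda_min A * (norm v)\<^sup>2"
    using pos[OF v(1)] v(2) by (simp add: power2_norm_eq_inner)
  then show ?thesis
    using v(1) by (simp add: zero_less_mult_iff)
qed

lemma scaled_minus_identity_sym_pos_def:
  assumes A: "sym_pos_def A" and \<gamma>: "1 / lambda_min A < \<gamma>"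
  shows "sym_pos_def (\<gamma> *\<^sub>R A - mat 1)"
  unfolding sym_pos_def_def
proof (intro conjI allI impI)
  have sym: "transpose A = A" using A by (simp add: sym_pos_def_def)
  then show "transpose (\<gamma> *\<^sub>R A - mat 1) = \<gamma> *\<^sub>R A - mat 1"
    by (simp add: transpose_def mat_def vec_eq_iff)
  have pos: "0 < lambda_min A" by (rule sym_pos_def_lambda_min_pos[OF A])
  then have "0 < \<gamma>" using \<gamma> by (meson divide_pos_pos less_trans zero_less_one)
  fix x :: "real^'a" assume "x \<noteq> 0"
  have "1 < \<gamma> * lambda_min A" using \<gamma> pos by (simp add: field_simps)
  then have "(norm x)\<^sup>2 < \<gamma> * lambda_min A * (norm x)\<^sup>2" using \<open>x \<noteq> 0\<close> by simp
  also have "\<dots> \<le> \<gamma> * (x \<bullet> (A *v x))"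
    using lambda_min_symmetric[OF sym] \<open>0 < \<gamma>\<close> by (metis mult.assoc mult_left_mono less_imp_le)
  finally show "0 < x \<bullet> ((\<gamma> *\<^sub>R A - mat 1) *v x)"
    by (simp add: matrix_vector_mult_diff_rdistrib scaleR_matrix_vector_assoc[symmetric]
        inner_diff_right power2_norm_eq_inner)
qed

section \<open>Affine monotone maps\<close>

text \<open>
  The metric \<open>P = \<gamma> A - I\<close> is chosen such that \<open>- P\<close> is the linear part of the forward step: then
  monotonicity of the proximal operator is precisely the statement that its contribution to the
  contraction inequality is nonpositive.
\<close>

lemma affine_prox_grad_field_contracting:
  fixes A :: "real^'n^'n" and g :: "real^'n \<Rightarrow> ereal"
  assumes g: "convex_fun g" "closed_fun g" "proper_fun g" and "0 < \<gamma>"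
    and F: "\<And>x. F x = A *v x + b" and P: "sym_pos_def (\<gamma> *\<^sub>R A - mat 1)"
  shows "strongly_inf_contracting (prox_grad_field \<gamma> g F) (\<gamma> *\<^sub>R A - mat 1) 1"
proof -
  define P where "P = \<gamma> *\<^sub>R A - mat 1"
  have P_mult: "P *v x = \<gamma> *\<^sub>R (A *v x) - x" for x
    by (simp add: P_def matrix_vector_mult_diff_rdistrib scaleR_matrix_vector_assoc[symmetric])
  let ?T = "\<lambda>x. prox \<gamma> g (x - \<gamma> *\<^sub>R F x)"
  have "(prox_grad_field \<gamma> g F x - prox_grad_field \<gamma> g F y) \<bullet> (P *v (x - y))
      \<le> - ((x - y) \<bullet> (P *v (x - y)))" for x y
  proof -
    have step: "(x - \<gamma> *\<^sub>R F x) - (y - \<gamma> *\<^sub>R F y) = - (P *v (x - y))"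
      by (simp add: F P_mult matrix_vector_mult_diff_distrib algebra_simps)
    have "0 \<le> (?T x - ?T y) \<bullet> ((x - \<gamma> *\<^sub>R F x) - (y - \<gamma> *\<^sub>R F y))"
      using prox_firmly_nonexpansive[OF g \<open>0 < \<gamma>\<close>] by (rule order_trans[OF zero_le_power2])
    then have "(?T x - ?T y) \<bullet> (P *v (x - y)) \<le> 0"
      unfolding step by simp
    moreover have "prox_grad_field \<gamma> g F x - prox_grad_field \<gamma> g F y = (?T x - ?T y) - (x - y)"
      by (simp add: prox_grad_field_def)
    ultimately show ?thesis
      by (simp add: inner_diff_left[of _ "x - y"])
  qed
  moreover have "continuous_on UNIV (prox_grad_field \<gamma> g F)"
    unfolding prox_grad_field_def F
    by (intro continuous_intros matrix_vector_mult_linear_continuous_on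
        continuous_on_compose2[OF lipschitz_on_continuous_on[OF prox_nonexpansive[OF g \<open>0 < \<gamma>\<close>]]]) simp
  ultimately show ?thesis
    using P unfolding strongly_inf_contracting_def P_def[symmetric]
    by (simp add: norm_wrt_sq)
qed

section \<open>Optimal step sizes\<close>

lemma monotone_rate_optimal:
  fixes m l :: real
  assumes "0 < m" "0 < l"
  shows "is_arg_max (\<lambda>\<gamma>. 1 - sqrt (1 - 2 * \<gamma> * m + \<gamma>\<^sup>2 * l\<^sup>2)) (\<lambda>\<gamma>. \<gamma> \<in> {0<..<2 * m / l\<^sup>2}) (m / l\<^sup>2)"
proof -
  have "1 - 2 * (m / l\<^sup>2) * m + (m / l\<^sup>2)\<^sup>2 * l\<^sup>2 \<le> 1 - 2 * \<gamma> * m + \<gamma>\<^sup>2 * l\<^sup>2" for \<gamma>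
  proof -
    have "0 \<le> (\<gamma> * l - m / l)\<^sup>2" by simp
    also have "\<dots> = (1 - 2 * \<gamma> * m + \<gamma>\<^sup>2 * l\<^sup>2) - (1 - 2 * (m / l\<^sup>2) * m + (m / l\<^sup>2)\<^sup>2 * l\<^sup>2)"
      using \<open>0 < l\<close> by (simp add: power2_eq_square field_simps)
    finally show ?thesis by simp
  qed
  then show ?thesis
    using assms by (auto simp: is_arg_max_def not_less divide_strict_right_mono)
qed

text \<open>
  At \<open>2 / (m + l)\<close> the numbers \<open>1 - \<gamma> m\<close> and \<open>\<gamma> l - 1\<close> agree. The first is larger for smaller \<open>\<gamma>\<close>,
  the second for larger \<open>\<gamma>\<close>.
\<close>

lemma gradient_rate_optimal:
  fixes m l :: real
  assumes "0 < m" "m \<le> l"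
  shows "is_arg_max (\<lambda>\<gamma>. 1 - max \<bar>1 - \<gamma> * m\<bar> \<bar>1 - \<gamma> * l\<bar>) (\<lambda>\<gamma>. \<gamma> \<in> {0<..<2 / l}) (2 / (m + l))"
proof -
  have at_m: "1 - 2 / (m + l) * m = (l - m) / (m + l)"
    and at_l: "1 - 2 / (m + l) * l = - ((l - m) / (m + l))"
    using assms by (simp_all add: field_simps)
  define q where "q \<gamma> = max \<bar>1 - \<gamma> * m\<bar> \<bar>1 - \<gamma> * l\<bar>" for \<gamma>
  have "q (2 / (m + l)) = (l - m) / (m + l)"
    unfolding q_def at_m at_l using assms by simp
  also have "\<dots> \<le> q \<gamma>" for \<gamma>
  proof (cases "\<gamma> \<le> 2 / (m + l)")
    case True
    then have "\<gamma> * m \<le> 2 / (m + l) * m" using assms by (intro mult_right_mono) auto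
    then show ?thesis unfolding q_def using at_m by linarith
  next
    case False
    then have "2 / (m + l) * l \<le> \<gamma> * l" using assms by (intro mult_right_mono) auto
    then show ?thesis unfolding q_def using at_l by linarith
  qed
  finally have "q (2 / (m + l)) \<le> q \<gamma>" for \<gamma> .
  moreover have "2 / (m + l) \<in> {0<..<2 / l}"
    using assms by (simp add: field_simps)
  ultimately show ?thesis
    unfolding q_def[symmetric] is_arg_max_def by (auto simp: not_less)
qed

section \<open>Contraction of proximal gradient dynamics\<close>

theorem theorem7:
  fixes F :: "real^'n \<Rightarrow> real^'n" and g :: "real^'n \<Rightarrow> ereal" and m l :: real
  assumes "0 < m" and "strongly_monotone m F" and "l-lipschitz_on UNIV F"
    and "convex_fun g" and "closed_fun g" and "proper_fun g"
  shows
    "((\<forall>\<gamma> \<in> {0<..<2 * m / l\<^sup>2}.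
         strongly_inf_contracting (prox_grad_field \<gamma> g F) (mat 1)
           (1 - sqrt (1 - 2 * \<gamma> * m + \<gamma>\<^sup>2 * l\<^sup>2))) \<and>
      is_arg_max (\<lambda>\<gamma>. 1 - sqrt (1 - 2 * \<gamma> * m + \<gamma>\<^sup>2 * l\<^sup>2))
        (\<lambda>\<gamma>. \<gamma> \<in> {0<..<2 * m / l\<^sup>2}) (m / l\<^sup>2))
     \<and>
     ((\<exists>f \<mu>. strongly_convex \<mu> f \<and> (\<forall>x. GDERIV f x :> F x)) \<longrightarrow>
      (\<forall>\<gamma> \<in> {0<..<2 / l}.
         strongly_inf_contracting (prox_grad_field \<gamma> g F) (mat 1)
           (1 - max \<bar>1 - \<gamma> * m\<bar> \<bar>1 - \<gamma> * l\<bar>)) \<and>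
      is_arg_max (\<lambda>\<gamma>. 1 - max \<bar>1 - \<gamma> * m\<bar> \<bar>1 - \<gamma> * l\<bar>)
        (\<lambda>\<gamma>. \<gamma> \<in> {0<..<2 / l}) (2 / (m + l)))
     \<and>
     (\<forall>A b. sym_pos_def A \<and> (\<forall>x. F x = A *v x + b) \<longrightarrow>
      (\<forall>\<gamma> \<in> {1 / lambda_min A<..}.
         strongly_inf_contracting (prox_grad_field \<gamma> g F) (\<gamma> *\<^sub>R A - mat 1) 1))"
proof -
  note g = assms(4-6)
  have "m \<le> l" by (rule strongly_monotone_lipschitz_le[OF assms(2,3)])
  then have "0 < l" using \<open>0 < m\<close> by linarith
  have "strongly_inf_contracting (prox_grad_field \<gamma> g F) (mat 1)
      (1 - sqrt (1 - 2 * \<gamma> * m + \<gamma>\<^sup>2 * l\<^sup>2))" if "\<gamma> \<in> {0<..<2 * m / l\<^sup>2}" for \<gamma>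
  proof (rule prox_grad_field_contracting[OF g])
    show "0 < \<gamma>" using that by simp
    \<comment> \<open>The radicand is \<open>(1 - \<gamma> * m)\<^sup>2 + \<gamma>\<^sup>2 * (l\<^sup>2 - m\<^sup>2)\<close>, nonnegative because \<open>0 < m\<close> and \<open>m \<le> l\<close>.\<close>
    have "m\<^sup>2 \<le> l\<^sup>2" using \<open>0 < m\<close> \<open>m \<le> l\<close> by (intro power_mono) auto
    then have "0 \<le> (1 - \<gamma> * m)\<^sup>2 + \<gamma>\<^sup>2 * (l\<^sup>2 - m\<^sup>2)" by simp
    then have nonneg: "0 \<le> 1 - 2 * \<gamma> * m + \<gamma>\<^sup>2 * l\<^sup>2"
      by (simp add: power2_eq_square algebra_simps)
    show "(sqrt (1 - 2 * \<gamma> * m + \<gamma>\<^sup>2 * l\<^sup>2))-lipschitz_on UNIV (\<lambda>x. x - \<gamma> *\<^sub>R F x)"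
      using \<open>0 < \<gamma>\<close> nonneg by (intro forward_step_lipschitz assms) auto
    have "\<gamma> * l\<^sup>2 < 2 * m" using that \<open>0 < l\<close> by (simp add: field_simps)
    then have "\<gamma> * (\<gamma> * l\<^sup>2) < \<gamma> * (2 * m)" using \<open>0 < \<gamma>\<close> by simp
    then show "sqrt (1 - 2 * \<gamma> * m + \<gamma>\<^sup>2 * l\<^sup>2) < 1"
      by (simp add: power2_eq_square algebra_simps)
  qed
  moreover have "strongly_inf_contracting (prox_grad_field \<gamma> g F) (mat 1)
      (1 - max \<bar>1 - \<gamma> * m\<bar> \<bar>1 - \<gamma> * l\<bar>)"
    if grad: "\<And>x. GDERIV f x :> F x" and \<gamma>: "\<gamma> \<in> {0<..<2 / l}" for f \<gamma>
  proof (rule prox_grad_field_contracting[OF g])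
    show "0 < \<gamma>" using \<gamma> by simp
    then show "(max \<bar>1 - \<gamma> * m\<bar> \<bar>1 - \<gamma> * l\<bar>)-lipschitz_on UNIV (\<lambda>x. x - \<gamma> *\<^sub>R F x)"
      using \<open>m \<le> l\<close> by (intro gradient_step_lipschitz[OF grad] assms) auto
    have "\<gamma> * l < 2" using \<gamma> \<open>0 < l\<close> by (simp add: field_simps)
    moreover have "\<gamma> * m \<le> \<gamma> * l" using \<open>0 < \<gamma>\<close> \<open>m \<le> l\<close> by simp
    moreover have "0 < \<gamma> * m" using \<open>0 < \<gamma>\<close> \<open>0 < m\<close> by simp
    ultimately show "max \<bar>1 - \<gamma> * m\<bar> \<bar>1 - \<gamma> * l\<bar> < 1" by linarith
  qed
  moreover have "strongly_inf_contracting (prox_grad_field \<gamma> g F) (\<gamma> *\<^sub>R A - mat 1) 1"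
    if A: "sym_pos_def A" "\<And>x. F x = A *v x + b" and \<gamma>: "\<gamma> \<in> {1 / lambda_min A<..}" for A b \<gamma>
  proof (rule affine_prox_grad_field_contracting[OF g _ A(2)])
    show "0 < \<gamma>"
      using \<gamma> sym_pos_def_lambda_min_pos[OF A(1)] by (auto intro: less_trans[rotated])
    show "sym_pos_def (\<gamma> *\<^sub>R A - mat 1)"
      using \<gamma> by (intro scaled_minus_identity_sym_pos_def[OF A(1)]) simp
  qed
  ultimately show ?thesis
    using monotone_rate_optimal[OF \<open>0 < m\<close> \<open>0 < l\<close>] gradient_rate_optimal[OF \<open>0 < m\<close> \<open>m \<le> l\<close>]
    by blast
qed

end
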